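(* Let $k$ be a field of characteristic $0$ containing enough roots of unity, let $G$ be a group and let $\mathcal B$ be a $\Phi$-set theoretic basis of $k[G]$. Then there exist $A,N\le G$ such that: (1) $G\cong A\rtimes N$ with $A$ a finite abelian group; (2) $\mathcal B$ is a scalar multiple of the basis $\mathcal B_{A^\vee}=\{e_\chi u\mid \chi\in A^\vee,\ u\in N\}$; (3) $A=\{b\in\mathcal B\mid 1\in\mathrm{Supp}(b)\}$ are the idempotents in $\mathcal B$; (4) $\phi_{\mathcal B}:=\Phi_{k[G]}|_{\mathcal B\otimes\mathcal B}$ is equivalent to the solution $$e_\alpha u\otimes e_\beta v\ \mapsto\ \bigl(e_{\alpha(u\cdot\beta)^{-1}}\,u\bigr)\otimes\bigl(e_{u\cdot\beta}\,uv\bigr)\qquad(\alpha,\beta\in A^\vee,\ u,v\in N).$$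
   Context: For the group algebra $k[G]$, $\Phi_{k[G]}$ is the linear extension of $g\otimes h\mapsto g\otimes gh$ ($g,h\in G$). A $k$-basis $\mathcal B$ of $k[G]$ is $\Phi$-set theoretic if for all $b,c\in\mathcal B$ the element $\Phi_{k[G]}(b\otimes c)$ is a pure tensor $b'\otimes c'$ with $b',c'\in\mathcal B$; then $\phi_{\mathcal B}$ is regarded as the set-theoretic map $(b,c)\mapsto(b',c')$ on $\mathcal B\times\mathcal B$. For $x=\sum_g x_g g\in k[G]$, $\mathrm{Supp}(x)=\{g\mid x_g\neq 0\}$. "Enough roots of unity" means in practice that $k$ contains a primitive $|A|$-th root of unity, where $A$ is the finite group constructed from $\mathcal B$ as the union of the supports of those $b\in\mathcal B$ with $1\in\mathrm{Supp}(b)$. Here $A^\vee=\mathrm{Hom}(A,k^* )$, $e_\chi=\frac1{|A|}\sum_{a\in A}\chi(a^{-1})a$, and $N$ acts on $A^\vee$ by $(u\cdot\chi)(a)=\chi(u^{-1}au)$. The solution in (4) corresponds to the set-theoretic map $\bigl((\alpha,u),(\beta,v)\bigr)\mapsto\bigl((\alpha(u\cdot\beta)^{-1},u),(u\cdot\beta,uv)\bigr)$ on $A^\vee\times N$. Set-theoretic maps $s$ on $S\times S$ and $t$ on $T\times T$ are equivalent if there is a bijection $f:S\to T$ with $(f\times f)s=t(f\times f)$.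
   Formalization: In (3), false as printed (e.g. for the basis 2G), A is taken as the union of the supports of the b in the basis with 1 in Supp(b), and these b are shown to be exactly those for which b/c is idempotent, c being the scalar of (2). *)

theory Defs
  imports Complex_Main "HOL-Algebra.Coset" "HOL-Library.Poly_Mapping"
begin

section \<open>Free vector spaces and the group algebra\<close>

text \<open>
  The free \<open>'k\<close>-vector space on a set \<open>S\<close> consists of the finitely supported functions
  \<open>x :: 's \<Rightarrow>\<^sub>0 'k\<close> with \<^term>\<open>Poly_Mapping.keys x \<subseteq> S\<close>; the basis vector of \<open>s\<close> is \<^term>\<open>Poly_Mapping.single s 1\<close>,
  and \<^term>\<open>Poly_Mapping.keys x\<close> is the support of \<open>x\<close>. The multiplication on \<open>'s \<Rightarrow>\<^sub>0 'k\<close> provided by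
  \<^theory>\<open>HOL-Library.Poly_Mapping\<close> (which needs a monoid structure on the whole type) is not used.
\<close>

definition fs_scale :: "'k::field \<Rightarrow> ('s \<Rightarrow>\<^sub>0 'k) \<Rightarrow> ('s \<Rightarrow>\<^sub>0 'k)" where
  "fs_scale c x = Poly_Mapping.map ((*) c) x"

lemma lookup_fs_scale [simp]: "Poly_Mapping.lookup (fs_scale c x) s = c * Poly_Mapping.lookup x s"
  by (simp add: fs_scale_def Poly_Mapping.map.rep_eq when_def)

global_interpretation fs: vector_space "fs_scale :: 'k::field \<Rightarrow> ('s \<Rightarrow>\<^sub>0 'k) \<Rightarrow> ('s \<Rightarrow>\<^sub>0 'k)"
  by unfold_locales (auto intro!: poly_mapping_eqI simp: lookup_add algebra_simps)

definition lin_ext :: "('s \<Rightarrow> ('t \<Rightarrow>\<^sub>0 'k)) \<Rightarrow> ('s \<Rightarrow>\<^sub>0 'k::field) \<Rightarrow> ('t \<Rightarrow>\<^sub>0 'k)" where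
  "lin_ext f x = (\<Sum>s\<in>Poly_Mapping.keys x. fs_scale (Poly_Mapping.lookup x s) (f s))"

definition group_algebra :: "('g, 'm) monoid_scheme \<Rightarrow> ('g \<Rightarrow>\<^sub>0 'k::field) set" where
  "group_algebra G = {x. Poly_Mapping.keys x \<subseteq> carrier G}"

definition ga_mult ::
  "('g, 'm) monoid_scheme \<Rightarrow> ('g \<Rightarrow>\<^sub>0 'k::field) \<Rightarrow> ('g \<Rightarrow>\<^sub>0 'k) \<Rightarrow> ('g \<Rightarrow>\<^sub>0 'k)" where
  "ga_mult G x y = lin_ext (\<lambda>g. lin_ext (\<lambda>h. Poly_Mapping.single (g \<otimes>\<^bsub>G\<^esub> h) 1) y) x"

definition ga_basis :: "('g, 'm) monoid_scheme \<Rightarrow> ('g \<Rightarrow>\<^sub>0 'k::field) set \<Rightarrow> bool" where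
  "ga_basis G B \<longleftrightarrow> fs.independent B \<and> fs.span B = group_algebra G"


section \<open>The map \<open>\<Phi>\<close> and \<open>\<Phi>\<close>-set theoretic bases\<close>

text \<open>
  The space \<open>k[G] \<otimes> k[G]\<close> is identified with the free vector space on \<open>G \<times> G\<close>
  through its basis \<open>g \<otimes> h\<close>.
\<close>

definition tensor :: "('s \<Rightarrow>\<^sub>0 'k::field) \<Rightarrow> ('t \<Rightarrow>\<^sub>0 'k) \<Rightarrow> ('s \<times> 't \<Rightarrow>\<^sub>0 'k)" where
  "tensor x y = lin_ext (\<lambda>s. lin_ext (\<lambda>t. Poly_Mapping.single (s, t) 1) y) x"

definition Phi :: "('g, 'm) monoid_scheme \<Rightarrow> ('g \<times> 'g \<Rightarrow>\<^sub>0 'k::field) \<Rightarrow> ('g \<times> 'g \<Rightarrow>\<^sub>0 'k)" where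
  "Phi G = lin_ext (\<lambda>(g, h). Poly_Mapping.single (g, g \<otimes>\<^bsub>G\<^esub> h) 1)"

definition Phi_set_theoretic_basis ::
  "('g, 'm) monoid_scheme \<Rightarrow> ('g \<Rightarrow>\<^sub>0 'k::field) set \<Rightarrow> bool" where
  "Phi_set_theoretic_basis G B \<longleftrightarrow> ga_basis G B \<and>
     (\<forall>b\<in>B. \<forall>c\<in>B. \<exists>b'\<in>B. \<exists>c'\<in>B. Phi G (tensor b c) = tensor b' c')"

text \<open>
  The pair \<open>(b', c')\<close> is unique, because the \<open>b' \<otimes> c'\<close> with \<open>b', c'\<close> in a basis are
  linearly independent.
\<close>

definition phi_map ::
  "('g, 'm) monoid_scheme \<Rightarrow> ('g \<Rightarrow>\<^sub>0 'k::field) set \<Rightarrow>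
     ('g \<Rightarrow>\<^sub>0 'k) \<times> ('g \<Rightarrow>\<^sub>0 'k) \<Rightarrow> ('g \<Rightarrow>\<^sub>0 'k) \<times> ('g \<Rightarrow>\<^sub>0 'k)" where
  "phi_map G B = (\<lambda>(b, c).
     THE p. p \<in> B \<times> B \<and> Phi G (tensor b c) = tensor (fst p) (snd p))"

definition equivalent_maps ::
  "'s set \<Rightarrow> ('s \<times> 's \<Rightarrow> 's \<times> 's) \<Rightarrow> 't set \<Rightarrow> ('t \<times> 't \<Rightarrow> 't \<times> 't) \<Rightarrow> bool" where
  "equivalent_maps S s T t \<longleftrightarrow>
     (\<exists>f. bij_betw f S T \<and> (\<forall>p\<in>S \<times> S. map_prod f f (s p) = t (map_prod f f p)))"


section \<open>Roots of unity\<close>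

definition primitive_root_of_unity :: "nat \<Rightarrow> 'k::field \<Rightarrow> bool" where
  "primitive_root_of_unity n z \<longleftrightarrow> 0 < n \<and> z ^ n = 1 \<and> (\<forall>m. 0 < m \<and> m < n \<longrightarrow> z ^ m \<noteq> 1)"

definition one_supp_union :: "('g, 'm) monoid_scheme \<Rightarrow> ('g \<Rightarrow>\<^sub>0 'k::field) set \<Rightarrow> 'g set" where
  "one_supp_union G B = (\<Union>b\<in>{b \<in> B. \<one>\<^bsub>G\<^esub> \<in> Poly_Mapping.keys b}. Poly_Mapping.keys b)"

text \<open>
  Finiteness of this union is part of what has to be shown for a \<open>\<Phi>\<close>-set theoretic basis,
  so it is a premise here and not a conjunct.
\<close>

definition enough_roots_of_unity ::
  "('g, 'm) monoid_scheme \<Rightarrow> ('g \<Rightarrow>\<^sub>0 'k::field) set \<Rightarrow> bool" where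
  "enough_roots_of_unity G B \<longleftrightarrow>
     (finite (one_supp_union G B) \<longrightarrow>
       (\<exists>z::'k. primitive_root_of_unity (card (one_supp_union G B)) z))"


section \<open>Semidirect products\<close>

definition semidirect_product ::
  "('a, 'm) monoid_scheme \<Rightarrow> ('b, 'n) monoid_scheme \<Rightarrow> ('b \<Rightarrow> 'a \<Rightarrow> 'a) \<Rightarrow> ('a \<times> 'b) monoid" where
  "semidirect_product H K act =
     \<lparr>carrier = carrier H \<times> carrier K,
      mult = (\<lambda>(a, u) (b, v). (a \<otimes>\<^bsub>H\<^esub> act u b, u \<otimes>\<^bsub>K\<^esub> v)),
      one = (\<one>\<^bsub>H\<^esub>, \<one>\<^bsub>K\<^esub>)\<rparr>"

text \<open>
  \<open>G = A \<rtimes> N\<close> as an internal semidirect product: \<open>N\<close> acts on the normal subgroup \<open>A\<close> by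
  conjugation, and \<open>(a, u) \<mapsto> a u\<close> is an isomorphism.
\<close>

definition internal_semidirect :: "('g, 'm) monoid_scheme \<Rightarrow> 'g set \<Rightarrow> 'g set \<Rightarrow> bool" where
  "internal_semidirect G A N \<longleftrightarrow> A \<lhd> G \<and> subgroup N G \<and>
     (\<lambda>(a, u). a \<otimes>\<^bsub>G\<^esub> u) \<in>
       iso (semidirect_product (G\<lparr>carrier := A\<rparr>) (G\<lparr>carrier := N\<rparr>)
              (\<lambda>u a. u \<otimes>\<^bsub>G\<^esub> a \<otimes>\<^bsub>G\<^esub> inv\<^bsub>G\<^esub> u)) G"


section \<open>Characters and their idempotents\<close>

definition field_units :: "'k::field monoid" where
  "field_units = \<lparr>carrier = {x. x \<noteq> 0}, mult = (*), one = 1\<rparr>"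

text \<open>
  Characters are normalised to be extensional, so that each homomorphism on \<open>A\<close> is
  represented by exactly one function.
\<close>

definition characters :: "('g, 'm) monoid_scheme \<Rightarrow> 'g set \<Rightarrow> ('g \<Rightarrow> 'k::field) set" where
  "characters G A = hom (G\<lparr>carrier := A\<rparr>) field_units \<inter> extensional A"

definition char_act ::
  "('g, 'm) monoid_scheme \<Rightarrow> 'g set \<Rightarrow> 'g \<Rightarrow> ('g \<Rightarrow> 'k::field) \<Rightarrow> ('g \<Rightarrow> 'k)" where
  "char_act G A u \<chi> = (\<lambda>a\<in>A. \<chi> (inv\<^bsub>G\<^esub> u \<otimes>\<^bsub>G\<^esub> a \<otimes>\<^bsub>G\<^esub> u))"

definition char_idem ::
  "('g, 'm) monoid_scheme \<Rightarrow> 'g set \<Rightarrow> ('g \<Rightarrow> 'k::field) \<Rightarrow> ('g \<Rightarrow>\<^sub>0 'k)" where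
  "char_idem G A \<chi> =
     fs_scale (1 / of_nat (card A)) (\<Sum>a\<in>A. Poly_Mapping.single a (\<chi> (inv\<^bsub>G\<^esub> a)))"

definition dual_basis :: "('g, 'm) monoid_scheme \<Rightarrow> 'g set \<Rightarrow> 'g set \<Rightarrow> ('g \<Rightarrow>\<^sub>0 'k::field) set" where
  "dual_basis G A N =
     {ga_mult G (char_idem G A \<chi>) (Poly_Mapping.single u 1) | \<chi> u. \<chi> \<in> characters G A \<and> u \<in> N}"

definition dual_solution ::
  "('g, 'm) monoid_scheme \<Rightarrow> 'g set \<Rightarrow>
     (('g \<Rightarrow> 'k::field) \<times> 'g) \<times> (('g \<Rightarrow> 'k) \<times> 'g) \<Rightarrow> (('g \<Rightarrow> 'k) \<times> 'g) \<times> (('g \<Rightarrow> 'k) \<times> 'g)" where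
  "dual_solution G A = (\<lambda>((\<alpha>, u), (\<beta>, v)).
     ((\<lambda>a\<in>A. \<alpha> a * inverse (char_act G A u \<beta> a), u), (char_act G A u \<beta>, u \<otimes>\<^bsub>G\<^esub> v)))"

end

theory Submission
  imports Defs
begin

text \<open>
  Comparing coefficients, \<open>\<Phi>(b \<otimes> c) = b' \<otimes> c'\<close> says
  \<open>b(g) c(g\<inverse>h) = b'(g) c'(h)\<close>, so for \<open>g\<close> in the support of \<open>b\<close> the translate \<open>g c\<close> is
  proportional to \<open>c'\<close>. Hence \<open>G\<close> permutes the lines spanned by the basis; let \<open>A\<close> be the kernel of this
  action. If \<open>g\<^sub>1, g\<^sub>2\<close> are in the support of \<open>b\<close>, then \<open>g\<^sub>1\<inverse>g\<^sub>2\<close> fixes every line, so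
  each support is a single coset of \<open>A\<close>, and \<open>A\<close> acts on each basis vector by a character. Thus \<open>A\<close> is
  finite and abelian, and basis vectors correspond to pairs of a character and a coset. For \<open>\<chi>\<close> a character
  let \<open>\<lambda>(\<chi>, g)\<close> be the coefficient at \<open>g\<close> of the vector belonging to \<open>\<chi>\<close> and \<open>A g\<close>. Up to the
  factor \<open>d = \<lambda>(1, 1)\<close> it is multiplicative in \<open>\<chi>\<close>, and \<open>N\<close> consists of the \<open>g\<close> with
  \<open>\<lambda>(\<chi>, g) = d\<close> for all \<open>\<chi>\<close>. Every coset of \<open>A\<close> meets \<open>N\<close>: the sum of the basis vectors
  supported on the coset is nonzero, so \<open>\<Sum>\<^sub>\<chi> \<lambda>(\<chi>, x) \<noteq> 0\<close> for some \<open>x\<close> in it, which forces the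
  character \<open>\<lambda>(_, x) / d\<close> of the dual group to be trivial.
\<close>

section \<open>Coefficients\<close>

abbreviation "lookup \<equiv> Poly_Mapping.lookup"
abbreviation "keys \<equiv> Poly_Mapping.keys"

lemma lookup_lin_ext:
  "lookup (lin_ext f x) t = (\<Sum>s\<in>keys x. lookup x s * lookup (f s) t)"
  by (simp add: lin_ext_def lookup_sum)

lemma lookup_tensor: "lookup (tensor x y) (s, t) = lookup x s * lookup y t"
proof -
  have "lookup (lin_ext (\<lambda>t'. Poly_Mapping.single (s', t') 1) y) (s, t)
      = (if s' = s then lookup y t else 0)" for s'
  proof -
    have "lookup (lin_ext (\<lambda>t'. Poly_Mapping.single (s', t') 1) y) (s, t)
        = (\<Sum>t'\<in>keys y. if t' = t then (if s' = s then lookup y t else 0) else 0)"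
      unfolding lookup_lin_ext by (rule sum.cong) (auto simp: lookup_single when_def)
    then show ?thesis
      by (simp add: in_keys_iff)
  qed
  then have "lookup (tensor x y) (s, t)
      = (\<Sum>s'\<in>keys x. if s' = s then lookup x s * lookup y t else 0)"
    unfolding tensor_def lookup_lin_ext[of _ x] by (intro sum.cong) auto
  then show ?thesis
    by (simp add: in_keys_iff)
qed

lemma (in group) inv_cancel_left [simp]:
  assumes "x \<in> carrier G" "y \<in> carrier G"
  shows "inv x \<otimes> (x \<otimes> y) = y" "x \<otimes> (inv x \<otimes> y) = y"
  using assms by (simp_all flip: m_assoc)

text \<open>Only the pair \<open>x = g\<close>, \<open>y = inv g \<otimes> h\<close> satisfies
  \<open>(x, x \<otimes> y) = (g, h)\<close>, so one summand survives.\<close>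

lemma (in group) lookup_Phi:
  assumes f: "keys f \<subseteq> carrier G \<times> carrier G" and g: "g \<in> carrier G" and h: "h \<in> carrier G"
  shows "lookup (Phi G f) (g, h) = lookup f (g, inv g \<otimes> h)"
proof -
  have "lookup (Phi G f) (g, h)
      = (\<Sum>p\<in>keys f. if p = (g, inv g \<otimes> h) then lookup f (g, inv g \<otimes> h) else 0)"
    unfolding Phi_def lookup_lin_ext
  proof (rule sum.cong)
    fix p assume p: "p \<in> keys f"
    obtain x y where xy: "p = (x, y)" by (cases p)
    have "x \<in> carrier G" "y \<in> carrier G" using p xy f by auto
    then have "(x, x \<otimes> y) = (g, h) \<longleftrightarrow> p = (g, inv g \<otimes> h)"
      using g h xy by (auto simp: inv_solve_left inv_solve_left')
    then show "lookup f p * lookup ((case p of (g, h) \<Rightarrow> Poly_Mapping.single (g, g \<otimes> h) 1)) (g, h)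
        = (if p = (g, inv g \<otimes> h) then lookup f (g, inv g \<otimes> h) else 0)"
      using xy by (auto simp: lookup_single when_def)
  qed simp
  then show ?thesis by (simp add: in_keys_iff)
qed

text \<open>Allowing any finite \<open>S\<close> around the support of \<open>x\<close> lets
  products of elements supported in \<open>A\<close> be summed over all of \<open>A\<close>.\<close>

lemma (in group) lookup_ga_mult:
  assumes x: "keys x \<subseteq> S" "finite S" "S \<subseteq> carrier G" and y: "keys y \<subseteq> carrier G"
    and g: "g \<in> carrier G"
  shows "lookup (ga_mult G x y) g = (\<Sum>s\<in>S. lookup x s * lookup y (inv s \<otimes> g))"
proof -
  have "lookup (lin_ext (\<lambda>h. Poly_Mapping.single (s \<otimes> h) 1) y) g = lookup y (inv s \<otimes> g)"
    if s: "s \<in> carrier G" for s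
  proof -
    have "lookup (lin_ext (\<lambda>h. Poly_Mapping.single (s \<otimes> h) 1) y) g
        = (\<Sum>h\<in>keys y. if h = inv s \<otimes> g then lookup y (inv s \<otimes> g) else 0)"
      unfolding lookup_lin_ext
    proof (rule sum.cong)
      fix h assume "h \<in> keys y"
      then have "h \<in> carrier G" using y by auto
      then have "s \<otimes> h = g \<longleftrightarrow> h = inv s \<otimes> g"
        using s g by (auto simp: inv_solve_left inv_solve_left')
      then show "lookup y h * lookup (Poly_Mapping.single (s \<otimes> h) 1) g
          = (if h = inv s \<otimes> g then lookup y (inv s \<otimes> g) else 0)"
        by (auto simp: lookup_single when_def)
    qed simp
    then show ?thesis by (simp add: in_keys_iff)
  qed
  then have "lookup (ga_mult G x y) g = (\<Sum>s\<in>keys x. lookup x s * lookup y (inv s \<otimes> g))"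
    unfolding ga_mult_def lookup_lin_ext[of _ x] using x by (intro sum.cong) auto
  also have "\<dots> = (\<Sum>s\<in>S. lookup x s * lookup y (inv s \<otimes> g))"
    using x by (intro sum.mono_neutral_left) (auto simp: in_keys_iff)
  finally show ?thesis .
qed

lemma (in group) keys_ga_mult:
  fixes x y :: "'a \<Rightarrow>\<^sub>0 'k::field"
  assumes "keys x \<subseteq> carrier G" "keys y \<subseteq> carrier G"
  shows "keys (ga_mult G x y) \<subseteq> carrier G"
proof
  fix g assume "g \<in> keys (ga_mult G x y)"
  then have "lookup (ga_mult G x y) g \<noteq> 0" by (simp add: in_keys_iff)
  then have "(\<Sum>s\<in>keys x. lookup x s *
      (\<Sum>h\<in>keys y. lookup y h * lookup (Poly_Mapping.single (s \<otimes> h) 1) g)) \<noteq> 0"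
    by (simp add: ga_mult_def lookup_lin_ext)
  then obtain s where s: "s \<in> keys x"
    "(\<Sum>h\<in>keys y. lookup y h * lookup (Poly_Mapping.single (s \<otimes> h) 1) g) \<noteq> 0"
    by (metis (no_types, lifting) mult_zero_right sum.neutral)
  then obtain h where h: "h \<in> keys y" "lookup (Poly_Mapping.single (s \<otimes> h) (1 :: 'k)) g \<noteq> 0"
    by (metis (no_types, lifting) mult_zero_right sum.neutral)
  then have "g = s \<otimes> h" by (auto simp: lookup_single when_def split: if_splits)
  then show "g \<in> carrier G" using s h assms by auto
qed

lemma independent_imp_nonzero:
  "fs.independent B \<Longrightarrow> b \<in> B \<Longrightarrow> \<exists>g. lookup b g \<noteq> 0"
  by (metis fs.dependent_zero lookup_zero poly_mapping_eqI)

text \<open>Otherwise \<open>b\<close> would lie in the span of \<open>B - {b}\<close>.\<close>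

lemma proportional_imp_eq:
  assumes B: "fs.independent B" "b \<in> B" "c \<in> B" and eq: "\<And>g. lookup b g = k * lookup c g"
  shows "b = c"
proof (rule ccontr)
  assume "b \<noteq> c"
  have "b = fs_scale k c" by (rule poly_mapping_eqI) (simp add: eq)
  then have "b \<in> fs.span (B - {b})"
    using B \<open>b \<noteq> c\<close> by (simp add: fs.span_base fs.span_scale)
  then show False using B by (auto simp: fs.dependent_def)
qed

text \<open>Fixing one argument at a support point of one factor makes the remaining two factors
  proportional.\<close>

lemma tensor_basis_unique:
  assumes B: "fs.independent B" "b \<in> B" "c \<in> B" "b' \<in> B" "c' \<in> B"
    and eq: "tensor b c = tensor b' c'"
  shows "b = b' \<and> c = c'"
proof
  have lk: "lookup b g * lookup c h = lookup b' g * lookup c' h" for g h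
    by (metis eq lookup_tensor)
  obtain g0 where g0: "lookup b g0 \<noteq> 0" using B independent_imp_nonzero by blast
  obtain h0 where h0: "lookup c h0 \<noteq> 0" using B independent_imp_nonzero by blast
  show "b = b'"
    by (rule proportional_imp_eq[OF B(1,2,4), of "lookup c' h0 / lookup c h0"])
      (use lk[of _ h0] h0 in \<open>simp add: field_simps\<close>)
  show "c = c'"
    by (rule proportional_imp_eq[OF B(1,3,5), of "lookup b' g0 / lookup b g0"])
      (use lk[of g0] g0 in \<open>simp add: field_simps\<close>)
qed

section \<open>The group \<open>A\<close> and its characters\<close>

locale phi_basis = group G for G :: "('g, 'm) monoid_scheme" (structure) +
  fixes B :: "('g \<Rightarrow>\<^sub>0 'k::field_char_0) set"
  assumes basis: "Phi_set_theoretic_basis G B"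
begin

lemma indep: "fs.independent B"
  using basis by (simp add: Phi_set_theoretic_basis_def ga_basis_def)

lemma span_B: "fs.span B = group_algebra G"
  using basis by (simp add: Phi_set_theoretic_basis_def ga_basis_def)

lemma keys_B: "b \<in> B \<Longrightarrow> keys b \<subseteq> carrier G"
  using fs.span_base[of b B] span_B by (auto simp: group_algebra_def)

lemma lookup_outside: "b \<in> B \<Longrightarrow> lookup b g \<noteq> 0 \<Longrightarrow> g \<in> carrier G"
  using keys_B[of b] by (auto simp: in_keys_iff subset_iff)

lemma support_point:
  assumes "b \<in> B" obtains g where "g \<in> carrier G" "lookup b g \<noteq> 0"
  using independent_imp_nonzero[OF indep assms] lookup_outside[OF assms] by blast

lemma Phi_coeff:
  assumes "b \<in> B" "c \<in> B" "b' \<in> B" "c' \<in> B" "g \<in> carrier G" "h \<in> carrier G"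
    and "Phi G (tensor b c) = tensor b' c'"
  shows "lookup b g * lookup c (inv g \<otimes> h) = lookup b' g * lookup c' h"
proof -
  have "keys (tensor b c) \<subseteq> carrier G \<times> carrier G"
    using assms lookup_outside by (auto simp: in_keys_iff lookup_tensor)
  from lookup_Phi[OF this assms(5,6)] show ?thesis
    by (simp add: assms lookup_tensor)
qed

section \<open>Coordinate functionals on the group algebra\<close>

lemma span_induct_B:
  assumes "keys x \<subseteq> carrier G" "fs.subspace {x. P x}" "\<And>b. b \<in> B \<Longrightarrow> P b"
  shows "P x"
  using fs.span_induct[of x B P] assms span_B by (auto simp: group_algebra_def)

text \<open>If all basis vectors vanished at \<open>g\<close>, so would the whole group algebra,
  including the element \<open>g\<close> itself.\<close>

lemma covers:
  assumes g: "g \<in> carrier G" obtains b where "b \<in> B" "lookup b g \<noteq> 0"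
proof -
  have "\<exists>b\<in>B. lookup b g \<noteq> 0"
  proof (rule ccontr)
    assume "\<not> (\<exists>b\<in>B. lookup b g \<noteq> 0)"
    then have zero: "lookup b g = 0" if "b \<in> B" for b using that by blast
    have "lookup (Poly_Mapping.single g (1 :: 'k)) g = 0"
      by (rule span_induct_B[where P = "\<lambda>x. lookup x g = 0"])
        (use g zero in \<open>auto simp: fs.subspace_def lookup_add\<close>)
    then show False by simp
  qed
  then show thesis using that by blast
qed

text \<open>Coordinate functionals that agree on \<open>B\<close> agree on the whole group algebra,
  hence also on the group element \<open>p\<close>. This turns statements about basis coefficients
  into identities in the group.\<close>

lemma separates:
  assumes pq: "p \<in> carrier G" "q \<in> carrier G" and eq: "\<And>b. b \<in> B \<Longrightarrow> lookup b p = lookup b q"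
  shows "p = q"
proof -
  have "lookup (Poly_Mapping.single p (1 :: 'k)) p = lookup (Poly_Mapping.single p (1 :: 'k)) q"
    by (rule span_induct_B[where P = "\<lambda>x. lookup x p = lookup x q"])
      (use pq eq in \<open>auto simp: fs.subspace_def lookup_add\<close>)
  then show ?thesis by (auto simp: lookup_single when_def split: if_splits)
qed

text \<open>\<open>lookup c (inv g \<otimes> h)\<close> is the coefficient at \<open>h\<close> of
  the left translate of \<open>c\<close> by \<open>g\<close>. Pairing \<open>c\<close> with a
  \<open>b\<close> that has \<open>g\<close> in its support, and fixing the first coordinate at
  \<open>g\<close>, makes this translate proportional to the second output factor.\<close>

lemma translate:
  assumes g: "g \<in> carrier G" and c: "c \<in> B"
  obtains c' k where "c' \<in> B" "k \<noteq> 0" "\<And>h. h \<in> carrier G \<Longrightarrow> lookup c (inv g \<otimes> h) = k * lookup c' h"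
proof -
  obtain b where b: "b \<in> B" "lookup b g \<noteq> 0" using covers[OF g] .
  obtain b' c' where b': "b' \<in> B" "c' \<in> B" "Phi G (tensor b c) = tensor b' c'"
    using basis b c by (force simp: Phi_set_theoretic_basis_def)
  have eq: "lookup c (inv g \<otimes> h) = lookup b' g / lookup b g * lookup c' h" if "h \<in> carrier G" for h
    using Phi_coeff[OF b(1) c b'(1,2) g that b'(3)] b(2) by (simp add: field_simps)
  obtain y where y: "y \<in> carrier G" "lookup c y \<noteq> 0" using support_point[OF c] .
  \<comment> \<open>The translate is nonzero at \<open>g \<otimes> y\<close>, so the scalar cannot
    vanish.\<close>
  have "lookup b' g / lookup b g \<noteq> 0"
    using eq[of "g \<otimes> y"] g y by auto
  then show thesis using that b'(2) eq by blast
qed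

section \<open>The kernel of the action on the lines spanned by the basis\<close>

definition A where
  "A = {g \<in> carrier G. \<forall>c\<in>B. \<exists>k. \<forall>h\<in>carrier G. lookup c (inv g \<otimes> h) = k * lookup c h}"

text \<open>The eigenvalue of translation by \<open>a\<close> on \<open>c\<close>; as
  \<open>c\<close> is nonzero, \<open>SOME\<close> has only one candidate.\<close>

definition chi :: "('g \<Rightarrow>\<^sub>0 'k) \<Rightarrow> 'g \<Rightarrow> 'k" where
  "chi c = (\<lambda>a\<in>A. SOME k. \<forall>h\<in>carrier G. lookup c (inv a \<otimes> h) = k * lookup c h)"

lemma A_carrier: "a \<in> A \<Longrightarrow> a \<in> carrier G"
  by (simp add: A_def)

lemma AI:
  assumes "g \<in> carrier G"
    and "\<And>c. c \<in> B \<Longrightarrow> \<exists>k. \<forall>h\<in>carrier G. lookup c (inv g \<otimes> h) = k * lookup c h"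
  shows "g \<in> A"
  using assms by (auto simp: A_def)

lemma chi:
  assumes "a \<in> A" "c \<in> B" "h \<in> carrier G"
  shows "lookup c (inv a \<otimes> h) = chi c a * lookup c h"
proof -
  have "\<exists>k. \<forall>h\<in>carrier G. lookup c (inv a \<otimes> h) = k * lookup c h"
    using assms by (auto simp: A_def)
  then have "\<forall>h\<in>carrier G. lookup c (inv a \<otimes> h) = chi c a * lookup c h"
    unfolding chi_def restrict_apply'[OF assms(1)] by (rule someI_ex)
  then show ?thesis using assms(3) by (rule bspec)
qed

lemma chi_eqI:
  assumes "c \<in> B" "a \<in> A" "y \<in> carrier G" "lookup c y \<noteq> 0" "lookup c (inv a \<otimes> y) = k * lookup c y"
  shows "chi c a = k"
  using chi[OF assms(2,1,3)] assms by simp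

lemma chi_nonzero: assumes "c \<in> B" "a \<in> A" shows "chi c a \<noteq> 0"
proof
  assume 0: "chi c a = 0"
  obtain y where y: "y \<in> carrier G" "lookup c y \<noteq> 0" using support_point[OF assms(1)] .
  have a: "a \<in> carrier G" using assms A_carrier by blast
  show False using chi[OF assms(2,1), of "a \<otimes> y"] 0 y a by simp
qed

lemma subgroup_A: "subgroup A G"
proof (rule subgroupI)
  show "A \<subseteq> carrier G" by (auto simp: A_def)
  have "\<one> \<in> A" by (rule AI) (auto intro!: exI[of _ 1])
  then show "A \<noteq> {}" by auto
next
  fix a assume a: "a \<in> A"
  show "inv a \<in> A"
  proof (rule AI)
    fix c assume c: "c \<in> B"
    have "lookup c (inv (inv a) \<otimes> h) = inverse (chi c a) * lookup c h" if "h \<in> carrier G" for h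
      using chi[OF a c, of "a \<otimes> h"] that a chi_nonzero[OF c a]
      by (simp add: A_carrier field_simps flip: m_assoc)
    then show "\<exists>k. \<forall>h\<in>carrier G. lookup c (inv (inv a) \<otimes> h) = k * lookup c h" by (intro exI ballI)
  qed (use a in \<open>simp add: A_carrier\<close>)
next
  fix a b assume ab: "a \<in> A" "b \<in> A"
  show "a \<otimes> b \<in> A"
  proof (rule AI)
    fix c assume c: "c \<in> B"
    have "lookup c (inv (a \<otimes> b) \<otimes> h) = chi c b * chi c a * lookup c h" if "h \<in> carrier G" for h
      using chi[OF ab(2) c, of "inv a \<otimes> h"] chi[OF ab(1) c, of h] that ab
      by (simp add: A_carrier inv_mult_group m_assoc)
    then show "\<exists>k. \<forall>h\<in>carrier G. lookup c (inv (a \<otimes> b) \<otimes> h) = k * lookup c h" by (intro exI ballI)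
  qed (use ab in \<open>simp add: A_carrier\<close>)
qed

text \<open>Translation by \<open>inv g\<close> carries the line of \<open>c\<close> to that of some
  \<open>c'\<close>, on which \<open>a\<close> acts by \<open>chi c' a\<close>; transporting back by
  \<open>g\<close> keeps this eigenvalue.\<close>

lemma conj_A:
  assumes a: "a \<in> A" and g: "g \<in> carrier G" shows "g \<otimes> a \<otimes> inv g \<in> A"
proof (rule AI)
  fix c assume c: "c \<in> B"
  obtain c' k where k: "c' \<in> B" "k \<noteq> 0"
    "\<And>h. h \<in> carrier G \<Longrightarrow> lookup c (inv (inv g) \<otimes> h) = k * lookup c' h"
    using translate[of "inv g" c] g c by auto
  have "lookup c (inv (g \<otimes> a \<otimes> inv g) \<otimes> h) = chi c' a * lookup c h" if h: "h \<in> carrier G" for h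
  proof -
    have "lookup c (inv (g \<otimes> a \<otimes> inv g) \<otimes> h) = lookup c (inv (inv g) \<otimes> (inv a \<otimes> (inv g \<otimes> h)))"
      using a g h A_carrier by (simp add: inv_mult_group m_assoc)
    also have "\<dots> = chi c' a * (k * lookup c' (inv g \<otimes> h))"
      using k chi[OF a k(1)] a g h A_carrier by simp
    also have "k * lookup c' (inv g \<otimes> h) = lookup c (inv (inv g) \<otimes> (inv g \<otimes> h))"
      using k(3)[of "inv g \<otimes> h"] g h by simp
    also have "\<dots> = lookup c h" using g h by simp
    finally show ?thesis .
  qed
  then show "\<exists>k. \<forall>h\<in>carrier G. lookup c (inv (g \<otimes> a \<otimes> inv g) \<otimes> h) = k * lookup c h" by (intro exI ballI)
qed (use a g in \<open>simp add: A_carrier\<close>)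

lemma normal_A: "A \<lhd> G"
  unfolding normal_inv_iff using subgroup_A conj_A by blast

lemma conj_A': "a \<in> A \<Longrightarrow> g \<in> carrier G \<Longrightarrow> inv g \<otimes> a \<otimes> g \<in> A"
  using conj_A[of a "inv g"] by simp

text \<open>The output factor \<open>c'\<close> is the same for every support point of
  \<open>b\<close>, so the translates of \<open>c\<close> by \<open>g1\<close> and \<open>g2\<close>
  are both proportional to it. Hence \<open>inv g1 \<otimes> g2\<close> preserves the line of every
  \<open>c\<close>.\<close>

lemma quotient_in_A:
  assumes b: "b \<in> B" and g: "lookup b g1 \<noteq> 0" "lookup b g2 \<noteq> 0"
  shows "inv g1 \<otimes> g2 \<in> A"
proof (rule AI)
  have gc: "g1 \<in> carrier G" "g2 \<in> carrier G" using lookup_outside b g by auto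
  then show "inv g1 \<otimes> g2 \<in> carrier G" by simp
  fix c assume c: "c \<in> B"
  obtain b' c' where b': "b' \<in> B" "c' \<in> B" "Phi G (tensor b c) = tensor b' c'"
    using basis b c by (force simp: Phi_set_theoretic_basis_def)
  note ph = Phi_coeff[OF b c b'(1,2) _ _ b'(3)]
  obtain y where y: "y \<in> carrier G" "lookup c y \<noteq> 0" using support_point[OF c] .
  have nz: "lookup b' g1 \<noteq> 0"
    using ph[of g1 "g1 \<otimes> y"] gc y g by auto
  have "lookup c (inv (inv g1 \<otimes> g2) \<otimes> h)
      = lookup b g1 * lookup b' g2 / (lookup b g2 * lookup b' g1) * lookup c h"
    if h: "h \<in> carrier G" for h
  proof -
    have 1: "lookup b g2 * lookup c (inv (inv g1 \<otimes> g2) \<otimes> h) = lookup b' g2 * lookup c' (g1 \<otimes> h)"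
      using ph[of g2 "g1 \<otimes> h"] gc h by (simp add: inv_mult_group m_assoc)
    have 2: "lookup b g1 * lookup c h = lookup b' g1 * lookup c' (g1 \<otimes> h)"
      using ph[of g1 "g1 \<otimes> h"] gc h by simp
    have 3: "lookup c' (g1 \<otimes> h) = lookup b g1 * lookup c h / lookup b' g1"
      using 2 nz by (simp add: field_simps)
    show ?thesis using 1 g nz unfolding 3 by (simp add: field_simps)
  qed
  then show "\<exists>k. \<forall>h\<in>carrier G. lookup c (inv (inv g1 \<otimes> g2) \<otimes> h) = k * lookup c h" by (intro exI ballI)
qed

text \<open>One direction is \<open>quotient_in_A\<close>, with normality exchanging left and right
  quotients. For the other, translation by \<open>x \<otimes> inv g\<close> only rescales
  \<open>b\<close> and relates its coefficients at \<open>x\<close> and \<open>g\<close>.\<close>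

lemma support_coset:
  assumes b: "b \<in> B" and g: "lookup b g \<noteq> 0" and x: "x \<in> carrier G"
  shows "lookup b x \<noteq> 0 \<longleftrightarrow> x \<otimes> inv g \<in> A"
proof
  have gc: "g \<in> carrier G" using lookup_outside b g by auto
  {
    assume "lookup b x \<noteq> 0"
    then have "g \<otimes> (inv g \<otimes> x) \<otimes> inv g \<in> A"
      using conj_A[OF quotient_in_A[OF b g] gc] by simp
    then show "x \<otimes> inv g \<in> A" using gc x by simp
  next
    assume a: "x \<otimes> inv g \<in> A"
    have "lookup b (inv (x \<otimes> inv g) \<otimes> x) = chi b (x \<otimes> inv g) * lookup b x"
      by (rule chi[OF a b x])
    moreover have "inv (x \<otimes> inv g) \<otimes> x = g" using gc x by (simp add: inv_mult_group m_assoc)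
    ultimately show "lookup b x \<noteq> 0" using g by auto
  }
qed

lemma keys_one: assumes "b \<in> B" "\<one> \<in> keys b" shows "keys b = A"
proof -
  have "x \<in> keys b \<longleftrightarrow> x \<in> A" if "x \<in> carrier G" for x
    using support_coset[of b \<one> x] assms that by (simp add: in_keys_iff)
  then show ?thesis using keys_B[OF assms(1)] A_carrier by blast
qed

lemma A_eq_one_supp_union: "A = one_supp_union G B"
proof -
  obtain b where "b \<in> B" "lookup b \<one> \<noteq> 0" using covers[OF one_closed] .
  then have "\<exists>b\<in>B. \<one> \<in> keys b" by (auto simp: in_keys_iff)
  then show ?thesis using keys_one by (auto simp: one_supp_union_def)
qed

text \<open>\<open>A\<close> is the support of a basis vector, and supports are finite.\<close>

lemma finite_A: "finite A"
proof -
  obtain b where b: "b \<in> B" "lookup b \<one> \<noteq> 0" using covers[OF one_closed] .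
  then have "keys b = A" using keys_one by (simp add: in_keys_iff)
  then show ?thesis by (metis finite_keys)
qed

text \<open>Both elements act on each basis vector by scalars, and scalars commute;
  \<open>separates\<close> lifts this to the group.\<close>

lemma A_comm: assumes "a \<in> A" "b \<in> A" shows "a \<otimes> b = b \<otimes> a"
proof -
  have ac: "a \<in> carrier G" "b \<in> carrier G" using assms A_carrier by auto
  have "inv a \<otimes> inv b = inv b \<otimes> inv a"
  proof (rule separates)
    fix c assume c: "c \<in> B"
    show "lookup c (inv a \<otimes> inv b) = lookup c (inv b \<otimes> inv a)"
      using chi[OF assms(1) c, of "inv b"] chi[OF assms(2) c, of "inv a"]
        chi[OF assms(1) c, of \<one>] chi[OF assms(2) c, of \<one>] ac by simp
  qed (use ac in auto)
  then show ?thesis using ac by (metis inv_mult_group inv_inj inv_inv m_closed)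
qed

lemma comm_group_A: "comm_group (G\<lparr>carrier := A\<rparr>)"
  using subgroup.subgroup_is_group[OF subgroup_A is_group] A_comm
  by (auto intro: group.group_comm_groupI)

section \<open>The dual group of \<open>A\<close> and the conjugation action on it\<close>

abbreviation "chars \<equiv> characters G A :: ('g \<Rightarrow> 'k) set"

lemma chars_iff:
  "\<chi> \<in> chars \<longleftrightarrow> \<chi> \<in> extensional A \<and> (\<forall>a\<in>A. \<chi> a \<noteq> 0) \<and> (\<forall>a\<in>A. \<forall>b\<in>A. \<chi> (a \<otimes> b) = \<chi> a * \<chi> b)"
  by (auto simp: characters_def hom_def field_units_def)

lemma char_mult: "\<chi> \<in> chars \<Longrightarrow> a \<in> A \<Longrightarrow> b \<in> A \<Longrightarrow> \<chi> (a \<otimes> b) = \<chi> a * \<chi> b"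
  by (auto simp: chars_iff)

lemma char_nonzero: "\<chi> \<in> chars \<Longrightarrow> a \<in> A \<Longrightarrow> \<chi> a \<noteq> 0"
  by (auto simp: chars_iff)

lemma char_one: assumes "\<chi> \<in> chars" shows "\<chi> \<one> = 1"
  using char_mult[OF assms, of \<one> \<one>] char_nonzero[OF assms, of \<one>] subgroup.one_closed[OF subgroup_A]
  by simp

lemma char_inv: assumes "\<chi> \<in> chars" "a \<in> A" shows "\<chi> (inv a) = inverse (\<chi> a)"
proof -
  have "inv a \<in> A" using assms subgroup.m_inv_closed[OF subgroup_A] by auto
  then have "\<chi> (inv a) * \<chi> a = 1"
    using char_mult[OF assms(1), of "inv a" a] char_one[OF assms(1)] assms A_carrier by simp
  then show ?thesis by (metis inverse_unique mult.commute)
qed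

lemma char_ext: "\<chi> \<in> chars \<Longrightarrow> \<psi> \<in> chars \<Longrightarrow> (\<And>a. a \<in> A \<Longrightarrow> \<chi> a = \<psi> a) \<Longrightarrow> \<chi> = \<psi>"
  by (auto simp: chars_iff intro: extensionalityI)

lemma chi_char: assumes c: "c \<in> B" shows "chi c \<in> chars"
proof -
  have "chi c (a \<otimes> b) = chi c a * chi c b" if ab: "a \<in> A" "b \<in> A" for a b
  proof -
    obtain y where y: "y \<in> carrier G" "lookup c y \<noteq> 0" using support_point[OF c] .
    show ?thesis
      using chi[OF ab(2) c, of "inv a \<otimes> y"] chi[OF ab(1) c, of y] y ab
      by (intro chi_eqI[OF c subgroup.m_closed[OF subgroup_A] y])
        (auto simp: A_carrier inv_mult_group m_assoc)
  qed
  then show ?thesis using chi_nonzero[OF c] by (auto simp: chars_iff chi_def)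
qed

definition triv :: "'g \<Rightarrow> 'k" where "triv = (\<lambda>a\<in>A. 1)"

text \<open>Division is taken as the basic operation because it is the form in which the character
  of the first output factor of \<open>Phi\<close> appears.\<close>

definition quot :: "('g \<Rightarrow> 'k) \<Rightarrow> ('g \<Rightarrow> 'k) \<Rightarrow> 'g \<Rightarrow> 'k" where
  "quot \<alpha> \<beta> = (\<lambda>a\<in>A. \<alpha> a * inverse (\<beta> a))"

lemma triv_char [simp]: "triv \<in> chars"
  using subgroup.m_closed[OF subgroup_A] by (auto simp: chars_iff triv_def)

lemma quot_char [simp]: "\<alpha> \<in> chars \<Longrightarrow> \<beta> \<in> chars \<Longrightarrow> quot \<alpha> \<beta> \<in> chars"
  using subgroup.m_closed[OF subgroup_A] by (auto simp: chars_iff quot_def)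

lemma char_act_char [simp]:
  assumes "g \<in> carrier G" "\<beta> \<in> chars" shows "char_act G A g \<beta> \<in> chars"
proof -
  have "\<beta> (inv g \<otimes> (a \<otimes> b) \<otimes> g) = \<beta> (inv g \<otimes> a \<otimes> g) * \<beta> (inv g \<otimes> b \<otimes> g)" if "a \<in> A" "b \<in> A" for a b
  proof -
    have "inv g \<otimes> (a \<otimes> b) \<otimes> g = (inv g \<otimes> a \<otimes> g) \<otimes> (inv g \<otimes> b \<otimes> g)"
      using that assms A_carrier by (simp add: m_assoc inv_solve_left)
    then show ?thesis using char_mult assms conj_A' that by simp
  qed
  then show ?thesis
    using assms subgroup.m_closed[OF subgroup_A] conj_A' char_nonzero[OF assms(2)]
    by (auto simp: chars_iff char_act_def)
qed

lemma char_act_inv: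
  assumes "g \<in> carrier G" "\<beta> \<in> chars"
  shows "char_act G A g (char_act G A (inv g) \<beta>) = \<beta>"
proof (rule char_ext)
  fix a assume a: "a \<in> A"
  have "g \<otimes> (inv g \<otimes> a \<otimes> g) \<otimes> inv g = a"
    using assms a A_carrier by (simp add: m_assoc inv_solve_left')
  then show "char_act G A g (char_act G A (inv g) \<beta>) a = \<beta> a"
    using assms a conj_A' by (simp add: char_act_def)
qed (use assms in auto)

lemma quot_self: "\<alpha> \<in> chars \<Longrightarrow> quot \<alpha> \<alpha> = triv"
  by (intro char_ext quot_char triv_char) (auto simp: quot_def triv_def char_nonzero)

text \<open>Dividing by the inverse character \<open>quot triv \<gamma>\<close> undoes dividing by
  \<open>\<gamma>\<close>. This serves to reindex a sum over characters.\<close>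

lemma quot_bij: assumes "\<gamma> \<in> chars" shows "bij_betw (\<lambda>\<alpha>. quot \<alpha> \<gamma>) chars chars"
proof (rule bij_betw_byWitness[where f' = "\<lambda>\<alpha>. quot \<alpha> (quot triv \<gamma>)"])
  show "\<forall>\<alpha>\<in>chars. quot (quot \<alpha> \<gamma>) (quot triv \<gamma>) = \<alpha>"
    using assms by (auto intro!: char_ext) (simp add: quot_def triv_def char_nonzero)
  show "\<forall>\<alpha>\<in>chars. quot (quot \<alpha> (quot triv \<gamma>)) \<gamma> = \<alpha>"
    using assms by (auto intro!: char_ext) (simp add: quot_def triv_def char_nonzero)
qed (use assms in auto)

section \<open>Parametrising the basis by characters and cosets\<close>

lemma coeff_shift:
  assumes "b \<in> B" "a \<in> A" "g \<in> carrier G"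
  shows "lookup b (a \<otimes> g) = lookup b g * inverse (chi b a)"
  using chi[OF assms(2,1), of "a \<otimes> g"] assms chi_nonzero[OF assms(1,2)]
  by (simp add: A_carrier field_simps)

lemma coset_cases:
  assumes "x \<in> carrier G" "g \<in> carrier G" "x \<otimes> inv g \<in> A"
  obtains a where "a \<in> A" "x = a \<otimes> g"
  using assms by (metis inv_closed l_inv m_assoc r_one)

text \<open>Overlapping supports are one and the same coset, on which the character and the value at
  \<open>g\<close> determine all coefficients up to a common factor.\<close>

lemma basis_eqI:
  assumes bc: "b \<in> B" "c \<in> B" "chi b = chi c" and g: "lookup b g \<noteq> 0" "lookup c g \<noteq> 0"
  shows "b = c"
proof (rule proportional_imp_eq[OF indep bc(1,2)])
  fix x
  have gc: "g \<in> carrier G" using lookup_outside bc g by blast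
  consider "x \<notin> carrier G" | "x \<in> carrier G" "x \<otimes> inv g \<notin> A" | a where "a \<in> A" "x = a \<otimes> g"
    using coset_cases gc by blast
  then show "lookup b x = lookup b g / lookup c g * lookup c x"
  proof cases
    case 1
    then have "lookup b x = 0" "lookup c x = 0" using lookup_outside bc by blast+
    then show ?thesis by simp
  next
    case 2
    then have "lookup b x = 0" "lookup c x = 0" using support_coset bc g by blast+
    then show ?thesis by simp
  next
    case 3
    then show ?thesis using coeff_shift bc g gc by simp
  qed
qed

text \<open>An eigenvector for \<open>\<chi>\<close> on the coset of \<open>g\<close> is expanded in
  \<open>B\<close>. Since \<open>A\<close> acts diagonally on \<open>B\<close>, only vectors with
  character \<open>\<chi>\<close> contribute, and one of them must be nonzero at
  \<open>g\<close>.\<close>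

lemma char_occurs:
  assumes \<chi>: "\<chi> \<in> chars" and g: "g \<in> carrier G"
  shows "\<exists>b\<in>B. chi b = \<chi> \<and> lookup b g \<noteq> 0"
proof -
  \<comment> \<open>This is \<open>card A\<close> times \<open>e_\<chi> g\<close>.\<close>
  define x where "x = (\<Sum>a\<in>A. Poly_Mapping.single (a \<otimes> g) (\<chi> (inv a)))"
  have lx: "lookup x h = (if h \<otimes> inv g \<in> A then \<chi> (inv (h \<otimes> inv g)) else 0)"
    if h: "h \<in> carrier G" for h
  proof -
    have "lookup x h = (\<Sum>a\<in>A. if a = h \<otimes> inv g then \<chi> (inv (h \<otimes> inv g)) else 0)"
      unfolding x_def lookup_sum
    proof (rule sum.cong)
      fix a assume "a \<in> A"
      then have "a \<otimes> g = h \<longleftrightarrow> a = h \<otimes> inv g"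
        using g h A_carrier by (metis inv_solve_right)
      then show "lookup (Poly_Mapping.single (a \<otimes> g) (\<chi> (inv a))) h
          = (if a = h \<otimes> inv g then \<chi> (inv (h \<otimes> inv g)) else 0)"
        by (auto simp: lookup_single when_def)
    qed simp
    then show ?thesis using finite_A by simp
  qed
  have "keys x \<subseteq> carrier G"
    unfolding x_def by (rule order.trans[OF keys_sum]) (use g A_carrier in \<open>auto split: if_splits\<close>)
  then have "x \<in> fs.span B" by (simp add: span_B group_algebra_def)
  then obtain S r where S: "finite S" "S \<subseteq> B" and x: "x = (\<Sum>b\<in>S. fs_scale (r b) b)"
    by (auto simp: fs.span_explicit)
  \<comment> \<open>Translation by \<open>a\<close> scales the summand of \<open>b\<close> by
    \<open>chi b a\<close> but the whole of \<open>x\<close> by \<open>\<chi> a\<close>;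
    independence applies to the difference of the two expansions.\<close>
  have eigen: "r b * (chi b a - \<chi> a) = 0" if a: "a \<in> A" and b: "b \<in> S" for a b
  proof -
    have "(\<Sum>b\<in>S. fs_scale (r b * (chi b a - \<chi> a)) b) = 0"
    proof (rule poly_mapping_eqI)
      fix h
      show "lookup (\<Sum>b\<in>S. fs_scale (r b * (chi b a - \<chi> a)) b) h = lookup 0 h"
      proof (cases "h \<in> carrier G")
        case False
        then have "lookup b h = 0" if "b \<in> S" for b using lookup_outside S that by blast
        then show ?thesis by (simp add: lookup_sum)
      next
        case h: True
        have ac: "a \<in> carrier G" using a A_carrier by blast
        have mem: "inv a \<otimes> h \<otimes> inv g \<in> A \<longleftrightarrow> h \<otimes> inv g \<in> A"
        proof
          assume "inv a \<otimes> h \<otimes> inv g \<in> A"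
          then have "a \<otimes> (inv a \<otimes> h \<otimes> inv g) \<in> A" using a subgroup.m_closed[OF subgroup_A] by blast
          then show "h \<otimes> inv g \<in> A" using ac h g by (simp add: m_assoc)
        next
          assume "h \<otimes> inv g \<in> A"
          then have "inv a \<otimes> (h \<otimes> inv g) \<in> A"
            using a subgroup.m_closed[OF subgroup_A] subgroup.m_inv_closed[OF subgroup_A] by blast
          then show "inv a \<otimes> h \<otimes> inv g \<in> A" using ac h g by (simp add: m_assoc)
        qed
        have "\<chi> (inv (inv a \<otimes> h \<otimes> inv g)) = \<chi> a * \<chi> (inv (h \<otimes> inv g))"
          if m: "h \<otimes> inv g \<in> A"
        proof -
          have "inv (inv a \<otimes> h \<otimes> inv g) = inv (h \<otimes> inv g) \<otimes> a"
            using ac h g by (simp add: m_assoc inv_mult_group)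
          then show ?thesis
            using char_mult[OF \<chi> subgroup.m_inv_closed[OF subgroup_A m] a] by simp
        qed
        then have "lookup x (inv a \<otimes> h) = \<chi> a * lookup x h"
          using lx[of h] lx[of "inv a \<otimes> h"] ac h mem by simp
        moreover have "lookup x (inv a \<otimes> h) = (\<Sum>b\<in>S. r b * (chi b a * lookup b h))"
          unfolding x using chi[OF a _ h] S by (auto simp: lookup_sum intro!: sum.cong)
        moreover have "\<chi> a * lookup x h = (\<Sum>b\<in>S. r b * (\<chi> a * lookup b h))"
          unfolding x by (simp add: lookup_sum sum_distrib_left mult_ac)
        ultimately have "(\<Sum>b\<in>S. r b * (chi b a * lookup b h) - r b * (\<chi> a * lookup b h)) = 0"
          by (simp add: sum_subtractf)
        then show ?thesis
          by (simp only: lookup_sum lookup_fs_scale left_diff_distrib right_diff_distrib mult.assoc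
              lookup_zero)
      qed
    qed
    from fs.independentD[OF indep S this b] show ?thesis .
  qed
  have "lookup x g \<noteq> 0" using lx[OF g] g char_one[OF \<chi>] subgroup.one_closed[OF subgroup_A] by simp
  then have "(\<Sum>b\<in>S. r b * lookup b g) \<noteq> 0" by (simp add: x lookup_sum)
  then obtain b where b: "b \<in> S" "r b * lookup b g \<noteq> 0" by (meson sum.neutral)
  have "chi b = \<chi>"
    using eigen[OF _ b(1)] b S by (intro char_ext chi_char \<chi>) auto
  then show ?thesis using b S by auto
qed

text \<open>For a character \<open>\<chi>\<close> and a group element \<open>g\<close>, existence is
  \<open>char_occurs\<close> and uniqueness is \<open>basis_eqI\<close>. The vector depends only on
  the coset of \<open>g\<close>, whereas \<open>lam\<close> depends on the chosen point.\<close>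

definition bas :: "('g \<Rightarrow> 'k) \<Rightarrow> 'g \<Rightarrow> ('g \<Rightarrow>\<^sub>0 'k)" where
  "bas \<chi> g = (THE b. b \<in> B \<and> chi b = \<chi> \<and> lookup b g \<noteq> 0)"

definition lam :: "('g \<Rightarrow> 'k) \<Rightarrow> 'g \<Rightarrow> 'k" where
  "lam \<chi> g = lookup (bas \<chi> g) g"

lemma bas_eqI: "b \<in> B \<Longrightarrow> chi b = \<chi> \<Longrightarrow> lookup b g \<noteq> 0 \<Longrightarrow> bas \<chi> g = b"
  unfolding bas_def by (rule the_equality) (auto intro: basis_eqI)

lemma bas:
  assumes "\<chi> \<in> chars" "g \<in> carrier G"
  shows "bas \<chi> g \<in> B" "chi (bas \<chi> g) = \<chi>" "lookup (bas \<chi> g) g \<noteq> 0" "lam \<chi> g \<noteq> 0"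
  using char_occurs[OF assms] bas_eqI by (auto simp: lam_def)

lemma bas_coset:
  assumes "\<chi> \<in> chars" "g \<in> carrier G" "x \<in> carrier G" "x \<otimes> inv g \<in> A"
  shows "bas \<chi> x = bas \<chi> g"
  using bas[OF assms(1,2)] support_coset[of "bas \<chi> g" g x] assms by (intro bas_eqI) auto

text \<open>The coefficient identity at \<open>(g, g \<otimes> y)\<close> is compared with its
  shifts by \<open>inv a\<close>: shifting the second point gives the character of
  \<open>c'\<close>, shifting the first gives that of \<open>b'\<close>.\<close>

lemma Phi_step:
  assumes b: "b \<in> B" "c \<in> B" "b' \<in> B" "c' \<in> B" and eq: "Phi G (tensor b c) = tensor b' c'"
    and g: "lookup b g \<noteq> 0" and y: "lookup c y \<noteq> 0"
  shows "lookup b' g \<noteq> 0" "lookup c' (g \<otimes> y) \<noteq> 0"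
    "lookup b g * lookup c y = lookup b' g * lookup c' (g \<otimes> y)"
    "chi c' = char_act G A g (chi c)" "chi b' = quot (chi b) (char_act G A g (chi c))"
proof -
  have gc: "g \<in> carrier G" and yc: "y \<in> carrier G" using g y b lookup_outside by blast+
  note ph = Phi_coeff[OF b _ _ eq]
  show 1: "lookup b g * lookup c y = lookup b' g * lookup c' (g \<otimes> y)"
    using ph[of g "g \<otimes> y"] gc yc by simp
  then show nz: "lookup b' g \<noteq> 0" "lookup c' (g \<otimes> y) \<noteq> 0" using g y by auto
  have "chi c' a = chi c (inv g \<otimes> a \<otimes> g)" if a: "a \<in> A" for a
  proof (rule chi_eqI[OF b(4) a _ nz(2)])
    have ac: "a \<in> carrier G" using a A_carrier by blast
    have "inv g \<otimes> (inv a \<otimes> (g \<otimes> y)) = inv (inv g \<otimes> a \<otimes> g) \<otimes> y"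
      using ac gc yc by (simp add: inv_mult_group m_assoc)
    then have "lookup b g * (chi c (inv g \<otimes> a \<otimes> g) * lookup c y)
        = lookup b' g * lookup c' (inv a \<otimes> (g \<otimes> y))"
      using ph[of g "inv a \<otimes> (g \<otimes> y)"] chi[OF conj_A'[OF a gc] b(2) yc] gc yc ac by simp
    then have "lookup b' g * lookup c' (inv a \<otimes> (g \<otimes> y))
        = lookup b' g * (chi c (inv g \<otimes> a \<otimes> g) * lookup c' (g \<otimes> y))"
      using 1 by algebra
    then show "lookup c' (inv a \<otimes> (g \<otimes> y)) = chi c (inv g \<otimes> a \<otimes> g) * lookup c' (g \<otimes> y)"
      using nz by simp
  qed (use gc yc in simp)
  then show "chi c' = char_act G A g (chi c)"
    using gc b by (intro char_ext chi_char char_act_char) (auto simp: char_act_def)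
  have "chi b' a = chi b a * inverse (chi c (inv g \<otimes> a \<otimes> g))" if a: "a \<in> A" for a
  proof (rule chi_eqI[OF b(3) a gc nz(1)])
    have ac: "a \<in> carrier G" using a A_carrier by blast
    have conj: "inv g \<otimes> inv a \<otimes> g = inv (inv g \<otimes> a \<otimes> g)"
      using ac gc by (simp add: inv_mult_group m_assoc)
    \<comment> \<open>The conjugate of \<open>a\<close> now multiplies \<open>y\<close> without
      being inverted, which is why its character value enters inverted.\<close>
    have "inv (inv a \<otimes> g) \<otimes> (g \<otimes> y) = (inv g \<otimes> a \<otimes> g) \<otimes> y"
      using ac gc yc by (simp add: inv_mult_group m_assoc)
    then have "(chi b a * lookup b g) * (lookup c y * inverse (chi c (inv g \<otimes> a \<otimes> g)))
        = lookup b' (inv a \<otimes> g) * lookup c' (g \<otimes> y)"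
      using ph[of "inv a \<otimes> g" "g \<otimes> y"] chi[OF a b(1) gc]
        coeff_shift[OF b(2) conj_A'[OF a gc] yc] gc yc ac by simp
    then have "lookup b' (inv a \<otimes> g) * lookup c' (g \<otimes> y)
        = (chi b a * inverse (chi c (inv g \<otimes> a \<otimes> g)) * lookup b' g) * lookup c' (g \<otimes> y)"
      using 1 by algebra
    then show "lookup b' (inv a \<otimes> g) = chi b a * inverse (chi c (inv g \<otimes> a \<otimes> g)) * lookup b' g"
      using nz by simp
  qed
  then show "chi b' = quot (chi b) (char_act G A g (chi c))"
    using gc b by (intro char_ext chi_char quot_char char_act_char) (auto simp: quot_def char_act_def)
qed

text \<open>\<open>Phi_step\<close> identifies both output factors by character and support point.
  All later laws for \<open>lam\<close> are specialisations.\<close>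

lemma lam_mult:
  assumes "\<alpha> \<in> chars" "\<beta> \<in> chars" "g \<in> carrier G" "y \<in> carrier G"
  shows "lam \<alpha> g * lam \<beta> y
    = lam (quot \<alpha> (char_act G A g \<beta>)) g * lam (char_act G A g \<beta>) (g \<otimes> y)"
proof -
  let ?b = "bas \<alpha> g" and ?c = "bas \<beta> y"
  note b = bas[OF assms(1,3)] and c = bas[OF assms(2,4)]
  obtain b' c' where b': "b' \<in> B" "c' \<in> B" "Phi G (tensor ?b ?c) = tensor b' c'"
    using basis b(1) c(1) by (force simp: Phi_set_theoretic_basis_def)
  note st = Phi_step[OF b(1) c(1) b' b(3) c(3), unfolded b(2) c(2)]
  have "bas (quot \<alpha> (char_act G A g \<beta>)) g = b'" "bas (char_act G A g \<beta>) (g \<otimes> y) = c'"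
    using st b' by (auto intro: bas_eqI)
  then show ?thesis using st(3) by (simp add: lam_def)
qed

section \<open>Multiplicativity of the coefficients in the character\<close>

definition d :: 'k where "d = lam triv \<one>"

lemma d_nonzero: "d \<noteq> 0"
  by (simp add: d_def bas)

lemma char_act_one: "\<beta> \<in> chars \<Longrightarrow> char_act G A \<one> \<beta> = \<beta>"
  by (intro char_ext char_act_char) (auto simp: char_act_def A_carrier)

text \<open>With equal characters at the identity, \<open>lam_mult\<close> says that the square of
  \<open>lam \<beta> \<one>\<close> is \<open>d * lam \<beta> \<one>\<close>.\<close>

lemma lam_one: "\<beta> \<in> chars \<Longrightarrow> lam \<beta> \<one> = d"
  using lam_mult[of \<beta> \<beta> \<one> \<one>] bas(4)[of \<beta> \<one>]
  by (simp add: char_act_one quot_self d_def)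

text \<open>Taking \<open>y = \<one>\<close> and pulling \<open>\<gamma>\<close> back by
  \<open>inv g\<close> leaves a law at the single point \<open>g\<close>: \<open>lam _ g / d\<close>
  is a character of the dual group.\<close>

lemma lam_quot:
  assumes "\<alpha> \<in> chars" "\<gamma> \<in> chars" "g \<in> carrier G"
  shows "lam \<alpha> g * d = lam (quot \<alpha> \<gamma>) g * lam \<gamma> g"
  using lam_mult[of \<alpha> "char_act G A (inv g) \<gamma>" g \<one>] assms
  by (simp add: char_act_inv lam_one)

text \<open>Distinct characters give distinct independent vectors \<open>bas \<chi> \<one>\<close>,
  all in the span of the finite set \<open>A\<close>.\<close>

lemma finite_chars: "finite chars"
proof -
  define T where "T = (\<lambda>\<chi>. bas \<chi> \<one>) ` chars"
  have T: "T \<subseteq> B" by (auto simp: T_def bas)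
  have inj: "inj_on (\<lambda>\<chi>. bas \<chi> \<one>) chars" by (rule inj_onI) (metis bas(2) one_closed)
  have "b \<in> fs.span ((\<lambda>a. Poly_Mapping.single a 1) ` A)" if b: "b \<in> T" for b
  proof -
    have k: "keys b = A" using b keys_one by (auto simp: T_def bas in_keys_iff)
    have "b = (\<Sum>a\<in>A. fs_scale (lookup b a) (Poly_Mapping.single a 1))"
    proof (rule poly_mapping_eqI)
      fix h
      have "lookup (\<Sum>a\<in>A. fs_scale (lookup b a) (Poly_Mapping.single a 1)) h
          = (\<Sum>a\<in>A. if a = h then lookup b h else 0)"
        unfolding lookup_sum by (rule sum.cong) (auto simp: lookup_single when_def)
      also have "\<dots> = lookup b h" using finite_A k by (auto simp: in_keys_iff)
      finally show "lookup b h = lookup (\<Sum>a\<in>A. fs_scale (lookup b a) (Poly_Mapping.single a 1)) h" ..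
    qed
    also have "\<dots> \<in> fs.span ((\<lambda>a. Poly_Mapping.single a 1) ` A)"
      by (intro fs.span_sum fs.span_scale fs.span_base) auto
    finally show ?thesis .
  qed
  then have "finite T"
    using fs.independent_span_bound[OF _ fs.independent_mono[OF indep T]] finite_A by blast
  then show ?thesis using inj by (simp add: T_def finite_image_iff)
qed

section \<open>The complement \<open>N\<close>\<close>

text \<open>Rescaling \<open>e\<^sub>\<chi> u\<close> by a character of \<open>A\<^sup>\<or>\<close> amounts to moving \<open>u\<close> inside its coset, so the
  complement has to consist of those representatives for which no rescaling is left.\<close>
definition N where "N = {g \<in> carrier G. \<forall>\<chi>\<in>chars. lam \<chi> g = d}"

lemma N_carrier: "u \<in> N \<Longrightarrow> u \<in> carrier G"
  by (simp add: N_def)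

lemma lam_N: "u \<in> N \<Longrightarrow> \<chi> \<in> chars \<Longrightarrow> lam \<chi> u = d"
  by (simp add: N_def)

lemma N_meets_coset:
  assumes g: "g \<in> carrier G" obtains x where "x \<in> N" "x \<otimes> inv g \<in> A"
proof -
  define T where "T = (\<lambda>\<chi>. bas \<chi> g) ` chars"
  have inj: "inj_on (\<lambda>\<chi>. bas \<chi> g) chars" by (rule inj_onI) (metis bas(2) g)
  have T: "finite T" "T \<subseteq> B" using finite_chars bas(1) g by (auto simp: T_def)
  have "(\<Sum>b\<in>T. fs_scale 1 b) \<noteq> 0"
  proof
    assume "(\<Sum>b\<in>T. fs_scale 1 b) = 0"
    from fs.independentD[OF indep T this, of "bas triv g"] show False by (auto simp: T_def)
  qed
  then have "(\<Sum>\<chi>\<in>chars. bas \<chi> g) \<noteq> 0"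
    by (simp add: T_def sum.reindex[OF inj] o_def)
  then obtain x where x: "lookup (\<Sum>\<chi>\<in>chars. bas \<chi> g) x \<noteq> 0"
    by (metis lookup_zero poly_mapping_eqI)
  then obtain \<chi> where \<chi>: "\<chi> \<in> chars" "lookup (bas \<chi> g) x \<noteq> 0"
    unfolding lookup_sum by (meson sum.neutral)
  have xc: "x \<in> carrier G" using lookup_outside[OF bas(1)[OF \<chi>(1) g] \<chi>(2)] .
  have xg: "x \<otimes> inv g \<in> A"
    using support_coset[OF bas(1)[OF \<chi>(1) g] bas(3)[OF \<chi>(1) g] xc] \<chi>(2) by simp
  \<comment> \<open>Moving the base point to \<open>x\<close> turns the nonzero coefficient of the
    sum at \<open>x\<close> into a sum of values of \<open>lam\<close>.\<close>
  have "bas \<chi> x = bas \<chi> g" if "\<chi> \<in> chars" for \<chi> using bas_coset[OF that g xc xg] .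
  then have S: "(\<Sum>\<chi>\<in>chars. lam \<chi> x) \<noteq> 0"
    using x by (simp add: lookup_sum lam_def)
  have "lam \<gamma> x = d" if \<gamma>: "\<gamma> \<in> chars" for \<gamma>
  proof -
    \<comment> \<open>Orthogonality argument: reindexing by division by \<open>\<gamma>\<close>
      preserves the sum, which is nonzero and can be cancelled.\<close>
    have "(\<Sum>\<chi>\<in>chars. lam \<chi> x) * d = (\<Sum>\<chi>\<in>chars. lam (quot \<chi> \<gamma>) x) * lam \<gamma> x"
      unfolding sum_distrib_right by (rule sum.cong) (use lam_quot[OF _ \<gamma> xc] in auto)
    also have "(\<Sum>\<chi>\<in>chars. lam (quot \<chi> \<gamma>) x) = (\<Sum>\<chi>\<in>chars. lam \<chi> x)"
      by (rule sum.reindex_bij_betw[OF quot_bij[OF \<gamma>]])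
    finally show ?thesis using S by simp
  qed
  then have "x \<in> N" using xc by (simp add: N_def)
  then show thesis using xg that by blast
qed

text \<open>Points of one coset lie in the same supports, and at points of \<open>N\<close> every
  nonzero coefficient is \<open>d\<close>; so no basis vector tells \<open>x\<close> and
  \<open>y\<close> apart.\<close>

lemma N_coset_unique:
  assumes xy: "x \<in> N" "y \<in> N" "x \<otimes> inv y \<in> A" shows "x = y"
proof (rule separates)
  fix b assume b: "b \<in> B"
  note xc = N_carrier[OF xy(1)] and yc = N_carrier[OF xy(2)]
  show "lookup b x = lookup b y"
  proof (cases "lookup b y = 0")
    case False
    then have x: "lookup b x \<noteq> 0" using support_coset[OF b _ xc] xy(3) by blast
    then have "lookup b x = lam (chi b) x" "lookup b y = lam (chi b) y"
      using bas_eqI[OF b refl] False by (simp_all add: lam_def)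
    then show ?thesis using lam_N[OF _ chi_char[OF b]] xy by simp
  next
    case True
    have "y \<otimes> inv x \<in> A"
      using subgroup.m_inv_closed[OF subgroup_A xy(3)] xc yc by (simp add: inv_mult_group)
    then show ?thesis using support_coset[OF b _ yc] True by metis
  qed
qed (use xy N_carrier in auto)

lemma subgroup_N: "subgroup N G"
proof -
  have one: "\<one> \<in> N" by (simp add: N_def lam_one)
  have div: "inv x \<otimes> y \<in> N" if xy: "x \<in> N" "y \<in> N" for x y
  proof -
    have c: "x \<in> carrier G" "y \<in> carrier G" using xy N_carrier by auto
    \<comment> \<open>Since \<open>x\<close> times \<open>inv x \<otimes> y\<close> is
      \<open>y\<close>, the other three factors in \<open>lam_mult\<close> are all
      \<open>d\<close>.\<close>
    have "lam \<beta> (inv x \<otimes> y) = d" if \<beta>: "\<beta> \<in> chars" for \<beta>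
      using lam_mult[of triv \<beta> x "inv x \<otimes> y"] c xy \<beta> lam_N d_nonzero by simp
    then show ?thesis using c by (simp add: N_def)
  qed
  have inv: "inv x \<in> N" if "x \<in> N" for x
    using div[OF that one] N_carrier[OF that] by simp
  show ?thesis
  proof (rule subgroupI)
    fix x y assume "x \<in> N" "y \<in> N"
    then show "x \<otimes> y \<in> N" using div[OF inv, of x y] N_carrier by simp
  qed (use one inv N_carrier in auto)
qed

text \<open>\<open>N\<close> is a transversal of the cosets of \<open>A\<close>:
  \<open>N_coset_unique\<close> gives injectivity and \<open>N_meets_coset\<close>
  surjectivity.\<close>

lemma semidirect: "internal_semidirect G A N"
proof -
  have "bij_betw (\<lambda>(a, u). a \<otimes> u) (A \<times> N) (carrier G)"
  proof (rule bij_betwI')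
    fix p q assume "p \<in> A \<times> N" "q \<in> A \<times> N"
    then obtain a u b v where pq: "p = (a, u)" "q = (b, v)" "a \<in> A" "u \<in> N" "b \<in> A" "v \<in> N"
      by auto
    have c: "a \<in> carrier G" "u \<in> carrier G" "b \<in> carrier G" "v \<in> carrier G"
      using pq A_carrier N_carrier by auto
    have "a = b \<and> u = v" if eq: "a \<otimes> u = b \<otimes> v"
    proof -
      have "u = inv a \<otimes> (b \<otimes> v)" using eq c by (metis inv_cancel_left(1))
      then have "u \<otimes> inv v = inv a \<otimes> b" using c by (simp add: m_assoc)
      also have "\<dots> \<in> A"
        using pq subgroup.m_closed[OF subgroup_A] subgroup.m_inv_closed[OF subgroup_A] by blast
      finally have "u = v" using N_coset_unique pq by blast
      then show ?thesis using eq c by simp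
    qed
    then show "((case p of (a, u) \<Rightarrow> a \<otimes> u) = (case q of (a, u) \<Rightarrow> a \<otimes> u)) = (p = q)"
      using pq by auto
  next
    fix p assume "p \<in> A \<times> N"
    then show "(case p of (a, u) \<Rightarrow> a \<otimes> u) \<in> carrier G" using A_carrier N_carrier by auto
  next
    fix g assume g: "g \<in> carrier G"
    obtain x where x: "x \<in> N" "x \<otimes> inv g \<in> A" using N_meets_coset[OF g] .
    have xc: "x \<in> carrier G" using x N_carrier by blast
    have "inv (x \<otimes> inv g) \<in> A" using subgroup.m_inv_closed[OF subgroup_A x(2)] .
    moreover have "inv (x \<otimes> inv g) \<otimes> x = g" using xc g by (simp add: inv_mult_group m_assoc)
    ultimately show "\<exists>p\<in>A \<times> N. g = (case p of (a, u) \<Rightarrow> a \<otimes> u)"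
      using x by (intro bexI[of _ "(inv (x \<otimes> inv g), x)"]) auto
  qed
  moreover have "(a \<otimes> (u \<otimes> b \<otimes> inv u)) \<otimes> (u \<otimes> v) = (a \<otimes> u) \<otimes> (b \<otimes> v)"
    if "a \<in> A" "u \<in> N" "b \<in> A" "v \<in> N" for a u b v
    using that by (simp add: A_carrier N_carrier m_assoc)
  ultimately show ?thesis
    using normal_A subgroup_N A_carrier N_carrier
    by (auto simp: internal_semidirect_def iso_def hom_def semidirect_product_def)
qed

section \<open>Comparison with the dual basis\<close>

abbreviation "E \<chi> u \<equiv> ga_mult G (char_idem G A \<chi>) (Poly_Mapping.single u (1 :: 'k))"

text \<open>For \<open>u\<close> in \<open>N\<close> the coefficient at \<open>u\<close> is
  \<open>d\<close> in \<open>bas \<chi> u\<close> and \<open>1 / card A\<close> in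
  \<open>e_\<chi> u\<close>; this is their ratio.\<close>

definition scal :: 'k where "scal = d * of_nat (card A)"

lemma card_A_pos: "card A > 0"
  using finite_A subgroup.one_closed[OF subgroup_A] by (auto simp: card_gt_0_iff)

lemma scal_nonzero: "scal \<noteq> 0"
  using d_nonzero card_A_pos by (simp add: scal_def)

lemma lookup_char_idem:
  "lookup (char_idem G A \<chi>) h = (if h \<in> A then \<chi> (inv h) / of_nat (card A) else 0)"
proof -
  have "lookup (char_idem G A \<chi>) h
      = 1 / of_nat (card A) * (\<Sum>a\<in>A. if a = h then \<chi> (inv h) else 0)"
    by (auto simp: char_idem_def lookup_sum lookup_single when_def intro!: sum.cong)
  then show ?thesis using finite_A by simp
qed

lemma lookup_E:
  assumes u: "u \<in> carrier G" and h: "h \<in> carrier G"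
  shows "lookup (E \<chi> u) h
    = (if h \<otimes> inv u \<in> A then \<chi> (inv (h \<otimes> inv u)) / of_nat (card A) else 0)"
proof -
  have "keys (char_idem G A \<chi>) \<subseteq> A"
    by (auto simp: in_keys_iff lookup_char_idem split: if_splits)
  then have "lookup (E \<chi> u) h
      = (\<Sum>s\<in>A. lookup (char_idem G A \<chi>) s * lookup (Poly_Mapping.single u 1) (inv s \<otimes> h))"
    using u h finite_A A_carrier by (intro lookup_ga_mult) auto
  also have "\<dots> = (\<Sum>s\<in>A. if s = h \<otimes> inv u
      then \<chi> (inv (h \<otimes> inv u)) / of_nat (card A) else 0)"
  proof (rule sum.cong)
    fix s assume s: "s \<in> A"
    have "u = inv s \<otimes> h \<longleftrightarrow> s = h \<otimes> inv u"
      using s A_carrier u h by (metis inv_solve_left inv_solve_right)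
    then show "lookup (char_idem G A \<chi>) s * lookup (Poly_Mapping.single u 1) (inv s \<otimes> h)
        = (if s = h \<otimes> inv u then \<chi> (inv (h \<otimes> inv u)) / of_nat (card A) else 0)"
      using s by (auto simp: lookup_char_idem lookup_single when_def)
  qed simp
  finally show ?thesis using finite_A by simp
qed

text \<open>Both sides live on the coset of \<open>u\<close> and vary along it by
  \<open>\<chi>\<close>, so the coefficient at \<open>u\<close> decides. Membership in
  \<open>N\<close> makes the scalar independent of \<open>\<chi>\<close> and
  \<open>u\<close>.\<close>

lemma bas_eq_E:
  assumes \<chi>: "\<chi> \<in> chars" and u: "u \<in> N"
  shows "bas \<chi> u = fs_scale scal (E \<chi> u)"
proof (rule poly_mapping_eqI)
  fix h
  have uc: "u \<in> carrier G" using u N_carrier by blast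
  note b = bas[OF \<chi> uc]
  consider "h \<notin> carrier G" | "h \<in> carrier G" "h \<otimes> inv u \<notin> A" | a where "a \<in> A" "h = a \<otimes> u"
    using coset_cases uc by blast
  then show "lookup (bas \<chi> u) h = lookup (fs_scale scal (E \<chi> u)) h"
  proof cases
    case 1
    have "keys (char_idem G A \<chi>) \<subseteq> carrier G"
      using A_carrier by (auto simp: in_keys_iff lookup_char_idem split: if_splits)
    then have "keys (E \<chi> u) \<subseteq> carrier G"
      using uc by (intro keys_ga_mult) auto
    then have "lookup (E \<chi> u) h = 0" using 1 by (auto simp: in_keys_iff)
    then show ?thesis using 1 lookup_outside[OF b(1)] by auto
  next
    case 2
    then have "lookup (bas \<chi> u) h = 0" using support_coset[OF b(1,3)] by blast
    then show ?thesis using lookup_E[OF uc] 2 by simp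
  next
    case 3
    then have ac: "a \<in> carrier G" "h \<in> carrier G" using A_carrier uc by auto
    have "lookup (bas \<chi> u) h = d * inverse (\<chi> a)"
      using coeff_shift[OF b(1) 3(1) uc] 3 b(2) lam_N[OF u \<chi>] by (simp add: lam_def)
    moreover have "h \<otimes> inv u = a" using 3 ac uc by (simp add: m_assoc)
    ultimately show ?thesis
      using lookup_E[OF uc ac(2), of \<chi>] 3 char_inv[OF \<chi> 3(1)] card_A_pos by (simp add: scal_def)
  qed
qed

section \<open>Basis vectors as pairs of a character and an element of \<open>N\<close>\<close>

definition pos :: "('g \<Rightarrow>\<^sub>0 'k) \<Rightarrow> 'g" where
  "pos b = (THE u. u \<in> N \<and> lookup b u \<noteq> 0)"

lemma pos_eqI: assumes "b \<in> B" "u \<in> N" "lookup b u \<noteq> 0" shows "pos b = u"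
  unfolding pos_def
proof (rule the_equality)
  fix v assume v: "v \<in> N \<and> lookup b v \<noteq> 0"
  then have "v \<otimes> inv u \<in> A" using support_coset[OF assms(1,3)] N_carrier by blast
  then show "v = u" using N_coset_unique v assms by blast
qed (use assms in simp)

lemma pos: assumes b: "b \<in> B" shows "pos b \<in> N" "lookup b (pos b) \<noteq> 0"
proof -
  obtain g where g: "g \<in> carrier G" "lookup b g \<noteq> 0" using support_point[OF b] .
  obtain x where x: "x \<in> N" "x \<otimes> inv g \<in> A" using N_meets_coset[OF g(1)] .
  then have "lookup b x \<noteq> 0" using support_coset[OF b g(2)] N_carrier by blast
  then show "pos b \<in> N" "lookup b (pos b) \<noteq> 0" using pos_eqI[OF b x(1)] x by auto
qed

lemma bas_chi_pos: "b \<in> B \<Longrightarrow> bas (chi b) (pos b) = b"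
  using pos by (intro bas_eqI) auto

lemma B_eq_dual_basis: "B = fs_scale scal ` dual_basis G A N"
proof
  show "B \<subseteq> fs_scale scal ` dual_basis G A N"
  proof
    fix b assume b: "b \<in> B"
    then have "b = fs_scale scal (E (chi b) (pos b))"
      using bas_chi_pos bas_eq_E chi_char pos by metis
    then show "b \<in> fs_scale scal ` dual_basis G A N"
      using b chi_char pos unfolding dual_basis_def by blast
  qed
  show "fs_scale scal ` dual_basis G A N \<subseteq> B"
    using bas_eq_E bas(1) N_carrier by (force simp: dual_basis_def)
qed

text \<open>If the identity is in the support, \<open>e\<close> is an \<open>e_\<chi>\<close> and
  each of the \<open>card A\<close> terms of the convolution at \<open>g\<close> is
  \<open>e(g) / card A\<close>. Conversely, idempotence writes a support point \<open>u\<close> as a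
  product of two support points, which forces the first of them into \<open>A\<close>.\<close>

lemma idempotent_iff:
  assumes b: "b \<in> B"
  defines "e \<equiv> fs_scale (inverse scal) b"
  shows "\<one> \<in> keys b \<longleftrightarrow> ga_mult G e e = e"
proof
  have le: "lookup e h = lookup b h / scal" for h by (simp add: e_def field_simps)
  have kb: "keys e = keys b" by (auto simp: in_keys_iff le scal_nonzero)
  have ke: "keys e \<subseteq> carrier G" unfolding kb by (rule keys_B[OF b])
  {
    assume one: "\<one> \<in> keys b"
    have kA: "keys e \<subseteq> A" unfolding kb keys_one[OF b one] ..
    have N1: "\<one> \<in> N" using subgroup.one_closed[OF subgroup_N] .
    have "b = fs_scale scal (E (chi b) \<one>)"
      using bas_eq_E[OF chi_char[OF b] N1] bas_eqI[OF b refl] one by (simp add: in_keys_iff)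
    then have lA: "lookup e h = (if h \<in> A then chi b (inv h) / of_nat (card A) else 0)"
      if "h \<in> carrier G" for h
      using lookup_E[OF one_closed that, of "chi b"] that scal_nonzero le
      by (metis (no_types, lifting) lookup_fs_scale nonzero_mult_div_cancel_left inv_one r_one)
    show "ga_mult G e e = e"
    proof (rule poly_mapping_eqI)
      fix g
      show "lookup (ga_mult G e e) g = lookup e g"
      proof (cases "g \<in> carrier G")
        case False
        then show ?thesis using keys_ga_mult[OF ke ke] ke by (metis in_keys_iff subsetD)
      next
        case g: True
        have mult: "lookup (ga_mult G e e) g = (\<Sum>s\<in>A. lookup e s * lookup e (inv s \<otimes> g))"
          using kA finite_A A_carrier ke g by (intro lookup_ga_mult) auto
        have "lookup e s * lookup e (inv s \<otimes> g) = lookup e g / of_nat (card A)" if s: "s \<in> A" for s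
        proof -
          have sc: "s \<in> carrier G" using s A_carrier by blast
          have "inv s \<otimes> g \<in> A \<longleftrightarrow> g \<in> A"
            using s g sc subgroup.m_closed[OF subgroup_A] subgroup.m_inv_closed[OF subgroup_A]
            by (metis inv_cancel_left(2))
          moreover have "chi b (inv s) * chi b (inv (inv s \<otimes> g)) = chi b (inv g)" if gA: "g \<in> A"
          proof -
            have "inv g = inv (inv s \<otimes> g) \<otimes> inv s" using sc g by (simp add: inv_mult_group m_assoc)
            then show ?thesis
              using char_mult[OF chi_char[OF b], of "inv (inv s \<otimes> g)" "inv s"] s gA
                subgroup.m_closed[OF subgroup_A] subgroup.m_inv_closed[OF subgroup_A]
              by (simp add: mult.commute)
          qed
          ultimately show ?thesis using lA[of s] lA[of "inv s \<otimes> g"] lA[OF g] s sc g by simp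
        qed
        then show ?thesis using mult card_A_pos by simp
      qed
    qed
  next
    assume eq: "ga_mult G e e = e"
    obtain u where u: "u \<in> carrier G" "lookup b u \<noteq> 0" using support_point[OF b] .
    have "(\<Sum>s\<in>keys e. lookup e s * lookup e (inv s \<otimes> u)) = lookup e u"
      using lookup_ga_mult[OF order.refl finite_keys ke ke u(1)] eq by simp
    also have "\<dots> \<noteq> 0" using u scal_nonzero by (simp add: le)
    finally have "(\<Sum>s\<in>keys e. lookup e s * lookup e (inv s \<otimes> u)) \<noteq> 0" .
    then obtain s where "lookup e s * lookup e (inv s \<otimes> u) \<noteq> 0" by (meson sum.neutral)
    then have s: "lookup b s \<noteq> 0" "lookup b (inv s \<otimes> u) \<noteq> 0" by (auto simp: le)
    have sc: "s \<in> carrier G" using lookup_outside b s by blast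
    have "(inv s \<otimes> u) \<otimes> inv u \<in> A"
      using support_coset[OF b u(2)] s sc u(1) by simp
    then have "\<one> \<otimes> inv s \<in> A" using sc u by (simp add: m_assoc)
    then show "\<one> \<in> keys b"
      using support_coset[OF b s(1) one_closed] by (simp add: in_keys_iff)
  }
qed

lemma phi_map_eq:
  assumes "b \<in> B" "c \<in> B" "b' \<in> B" "c' \<in> B" "Phi G (tensor b c) = tensor b' c'"
  shows "phi_map G B (b, c) = (b', c')"
  unfolding phi_map_def case_prod_conv
proof (rule the_equality)
  fix p assume p: "p \<in> B \<times> B \<and> Phi G (tensor b c) = tensor (fst p) (snd p)"
  then have "fst p \<in> B" "snd p \<in> B" "tensor (fst p) (snd p) = tensor b' c'" using assms(5) by auto
  then show "p = (b', c')"
    using tensor_basis_unique[OF indep _ _ assms(3,4)] by (simp add: prod_eq_iff)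
qed (use assms in simp)

text \<open>Evaluating \<open>Phi_step\<close> at the representatives in \<open>N\<close> yields
  both output characters; closure of \<open>N\<close> under products identifies the representative
  of the second factor.\<close>

lemma equivalent_dual_solution:
  "equivalent_maps B (phi_map G B) (chars \<times> N) (dual_solution G A)"
proof -
  define f where "f = (\<lambda>b. (chi b, pos b))"
  have "bij_betw f B (chars \<times> N)"
  proof (rule bij_betw_byWitness[where f' = "\<lambda>(\<chi>, u). bas \<chi> u"])
    have "chi (bas \<chi> u) = \<chi>" "pos (bas \<chi> u) = u" if "\<chi> \<in> chars" "u \<in> N" for \<chi> u
      using that bas N_carrier pos_eqI by auto
    then show "\<forall>p\<in>chars \<times> N. f (case p of (\<chi>, u) \<Rightarrow> bas \<chi> u) = p" by (auto simp: f_def)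
  qed (use bas N_carrier bas_chi_pos pos chi_char in \<open>auto simp: f_def\<close>)
  moreover have "map_prod f f (phi_map G B p) = dual_solution G A (map_prod f f p)"
    if mem: "p \<in> B \<times> B" for p
  proof -
    obtain b c where p: "p = (b, c)" "b \<in> B" "c \<in> B" using mem by auto
    obtain b' c' where b': "b' \<in> B" "c' \<in> B" "Phi G (tensor b c) = tensor b' c'"
      using basis p by (force simp: Phi_set_theoretic_basis_def)
    note st = Phi_step[OF p(2,3) b' pos(2)[OF p(2)] pos(2)[OF p(3)]]
    have "pos b' = pos b" using pos_eqI[OF b'(1) pos(1)[OF p(2)] st(1)] .
    moreover have "pos c' = pos b \<otimes> pos c"
      using pos_eqI[OF b'(2) subgroup.m_closed[OF subgroup_N pos(1)[OF p(2)] pos(1)[OF p(3)]] st(2)] .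
    ultimately show ?thesis
      using phi_map_eq[OF p(2,3) b'] st(4,5) p(1)
      by (simp add: f_def dual_solution_def quot_def)
  qed
  ultimately show ?thesis by (auto simp: equivalent_maps_def)
qed

end

theorem theorem5:
  fixes G :: "('g, 'm) monoid_scheme"
    and B :: "('g \<Rightarrow>\<^sub>0 'k::field_char_0) set"
  assumes "group G"
    and "Phi_set_theoretic_basis G B"
    and "enough_roots_of_unity G B"
  shows "\<exists>A N. subgroup A G \<and> subgroup N G \<and>
    (internal_semidirect G A N \<and> finite A \<and> comm_group (G\<lparr>carrier := A\<rparr>)) \<and>
    (\<exists>c::'k. c \<noteq> 0 \<and>
       B = fs_scale c ` dual_basis G A N \<and>
       A = one_supp_union G B \<and>
       {b \<in> B. \<one>\<^bsub>G\<^esub> \<in> Poly_Mapping.keys b} =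
         {b \<in> B. ga_mult G (fs_scale (inverse c) b) (fs_scale (inverse c) b) = fs_scale (inverse c) b}) \<and>
    equivalent_maps B (phi_map G B)
      ((characters G A :: ('g \<Rightarrow> 'k) set) \<times> N) (dual_solution G A)"
proof -
  interpret phi_basis G B
    using assms(1,2) by (simp add: phi_basis_def phi_basis_axioms_def)
  show ?thesis
    by (intro exI[of _ A] exI[of _ N] exI[of _ scal] conjI subgroup_A subgroup_N semidirect finite_A
        comm_group_A scal_nonzero B_eq_dual_basis A_eq_one_supp_union equivalent_dual_solution)
      (use idempotent_iff in blast)
qed

end
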